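(* Let $n\ge 1$ and let $V\subset\mathbb{D}^{n+1}$ be a set containing two points with different $w$-coordinates. Let $\pi V\subset\mathbb{D}^n$ be the projection of $V$ onto the first $n$ coordinates. Suppose $w|_V$ has a nontrivial norm 1 holomorphic extension $F$ to $\mathbb{D}^{n+1}$. Then there is a unique holomorphic function $f:\mathbb{D}^n\to\mathbb{D}$ such that $F(z,f(z))=f(z)$ for all $z\in\mathbb{D}^n$ and $V=\{(z,f(z)):z\in\pi V\}$.
   Context: $\mathbb{D}$ is the open unit disk in $\mathbb{C}$. Points of $\mathbb{D}^{n+1}$ are written $(z,w)$ with $z\in\mathbb{D}^n$ and $w\in\mathbb{D}$; $w$ also denotes the coordinate function $(z,w)\mapsto w$. A nontrivial norm 1 holomorphic extension of $w|_V$ is a holomorphic function $F:\mathbb{D}^{n+1}\to\mathbb{C}$ such that $F$ is not identically the function $w$, $F(z,w)=w$ for all $(z,w)\in V$, and $\sup_{\mathbb{D}^{n+1}}|F|\le 1$. The set $V$ is arbitrary (no analytic structure assumed). *)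

theory Defs
  imports "HOL-Analysis.Analysis" "HOL-Library.FuncSet"
begin

definition polydisc :: "(complex ^ 'm) set" where
  "polydisc = {z. \<forall>i. norm (z $ i) < 1}"

text \<open>Holomorphy of functions of several complex variables: at every point of the (open) set the
  function has a Frechet derivative that is linear over the complex numbers.\<close>

definition holomorphic_several_on ::
    "(complex ^ 'm \<Rightarrow> complex) \<Rightarrow> (complex ^ 'm) set \<Rightarrow> bool"  (infixl "holomorphic'_several'_on" 50)
  where
  "f holomorphic_several_on S \<longleftrightarrow>
     (\<forall>z\<in>S. \<exists>f'. (f has_derivative f') (at z) \<and> Vector_Spaces.linear (*s) (*) f')"

text \<open>Points of the (n+1)-dimensional space are vectors indexed by \<open>'n option\<close>: the coordinates of
  \<open>z\<close> sit at the indices \<open>Some j\<close>, and \<open>w\<close> sits at the index \<open>None\<close>.\<close>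

definition point :: "complex ^ 'n::finite \<Rightarrow> complex \<Rightarrow> complex ^ ('n::finite) option" where
  "point z w = (\<chi> i. case i of None \<Rightarrow> w | Some j \<Rightarrow> z $ j)"

definition z_coords :: "complex ^ ('n::finite) option \<Rightarrow> complex ^ 'n" where
  "z_coords p = (\<chi> j. p $ Some j)"

definition w_coord :: "complex ^ ('n::finite) option \<Rightarrow> complex" where
  "w_coord p = p $ None"

lemma z_coords_point [simp]: "z_coords (point z w) = z"
  by (simp add: z_coords_def point_def vec_eq_iff)

lemma w_coord_point [simp]: "w_coord (point z w) = w"
  by (simp add: w_coord_def point_def)

lemma point_coords [simp]: "point (z_coords p) (w_coord p) = p"
  by (simp add: z_coords_def w_coord_def point_def vec_eq_iff split: option.split)

lemma point_in_polydisc_iff [simp]: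
  "point z w \<in> polydisc \<longleftrightarrow> z \<in> polydisc \<and> w \<in> ball 0 1"
  by (auto simp: polydisc_def point_def split: option.splits)

definition nontrivial_norm1_extension ::
    "(complex ^ ('n::finite) option) set \<Rightarrow> (complex ^ ('n::finite) option \<Rightarrow> complex) \<Rightarrow> bool" where
  "nontrivial_norm1_extension V F \<longleftrightarrow>
     F holomorphic_several_on polydisc \<and>
     (\<exists>p\<in>polydisc. F p \<noteq> w_coord p) \<and>
     (\<forall>p\<in>V. F p = w_coord p) \<and>
     (\<forall>p\<in>polydisc. norm (F p) \<le> 1)"

end

theory Submission
  imports Defs "HOL-Complex_Analysis.Riemann_Mapping"
begin

text \<open>
  On the slice over \<open>z\<close> the extension gives a holomorphic self-map \<open>T\<^sub>z = F(z,\<cdot>)\<close> of the unit disc,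
  and a point of \<open>V\<close> over \<open>z\<close> is a fixed point of \<open>T\<^sub>z\<close>. The theorem says that every \<open>T\<^sub>z\<close> has exactly
  one fixed point \<open>f(z)\<close> and that \<open>f\<close> is holomorphic; the shape of \<open>V\<close> and the uniqueness of \<open>f\<close>
  then follow at once.

  Write \<open>\<rho>(a,b) = |b - a| / |1 - a\<^sup>* b|\<close>, where \<open>a\<^sup>*\<close> is the complex conjugate of \<open>a\<close>, for the pseudo-hyperbolic distance
  on the disc, and use the maximum of \<open>\<rho>\<close> over the coordinates on the polydisc. The Schwarz lemma
  on analytic discs shows that holomorphic maps from the polydisc to the disc do not increase these
  distances (\<open>schwarz_pick_polydisc\<close>).

  The key step is that a fixed point \<open>w\<^sub>0\<close> of \<open>T\<^sub>z\<close> over one point \<open>z\<^sub>0\<close> persists over every other \<open>z\<close>, at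
  a distance from \<open>w\<^sub>0\<close> not above that of \<open>z\<^sub>0\<close> and \<open>z\<close> (\<open>fixed_point_persists\<close>). Normalise \<open>w\<^sub>0 = 0\<close>
  and let \<open>r < 1\<close>. Brouwer's theorem gives a fixed point \<open>b\<close> of \<open>r T\<^sub>z\<close>. If \<open>|b|\<close> exceeded the distance
  of \<open>z\<^sub>0\<close> and \<open>z\<close>, then \<open>(z,b)\<close> would be at distance \<open>|b|\<close> from \<open>(z\<^sub>0,0)\<close>, so \<open>|T\<^sub>z(b)| \<le> |b| = r |T\<^sub>z(b)|\<close>,
  which is absurd. So all these \<open>b\<close> stay in a compact part of the disc, and a limit for
  \<open>r \<rightarrow> 1\<close> is a fixed point of \<open>T\<^sub>z\<close>.

  No \<open>T\<^sub>z\<close> is the identity. If the slice over \<open>z\<^sub>0\<close> is the identity, then by persistence the map \<open>T\<^sub>z\<close> has fixed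
  points within a constant distance less than 1 of every point of the disc, hence at least two of them, and a
  self-map of the disc with two fixed points is the identity (\<open>disc_self_map_eq_id\<close>). Then \<open>F = w\<close>
  everywhere, which is excluded (\<open>identity_slice_spreads\<close>). So fixed points are unique.

  Finally, persistence bounds the increments of \<open>f\<close> linearly by those of \<open>z\<close>, and \<open>\<partial>F/\<partial>w \<noteq> 1\<close> at a fixed
  point, again because \<open>T\<^sub>z\<close> would otherwise be the identity. Linearising \<open>F(z,f(z)) = f(z)\<close> and solving
  for the increment of \<open>f\<close> gives its complex derivative (\<open>has_derivative_fixed_point\<close>).
\<close>

section \<open>Moebius maps and the pseudo-hyperbolic distance\<close>

abbreviation disc_aut :: "complex \<Rightarrow> complex \<Rightarrow> complex" where
  "disc_aut \<equiv> Moebius_function 0"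

definition pseudo_dist :: "complex \<Rightarrow> complex \<Rightarrow> real" where
  "pseudo_dist a b = norm (disc_aut a b)"

lemma disc_aut_inverse:
  assumes "norm a < 1" "norm z < 1"
  shows "disc_aut a (disc_aut (- a) z) = z" "disc_aut (- a) (disc_aut a z) = z"
  using assms by (auto intro: Moebius_function_compose)

lemma disc_aut_in_disc:
  assumes "norm a < 1" "norm z < 1"
  shows "norm (disc_aut a z) < 1"
  using assms by (rule Moebius_function_norm_lt_1)

lemma disc_aut_simps [simp]: "disc_aut a a = 0" "disc_aut (- a) 0 = a"
  by (simp_all add: Moebius_function_eq_zero Moebius_function_of_zero)

lemma disc_aut_eq_iff:
  assumes "norm a < 1" "norm x < 1" "norm y < 1"
  shows "disc_aut a x = disc_aut a y \<longleftrightarrow> x = y"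
  using assms by (metis disc_aut_inverse(2))

lemma pseudo_dist_less_1: "norm a < 1 \<Longrightarrow> norm b < 1 \<Longrightarrow> pseudo_dist a b < 1"
  by (simp add: pseudo_dist_def disc_aut_in_disc)

lemma pseudo_dist_disc_aut:
  assumes "norm a < 1" "norm z < 1"
  shows "pseudo_dist a (disc_aut (- a) z) = norm z"
  using assms by (simp add: pseudo_dist_def disc_aut_inverse)

lemma pseudo_dist_commute: "pseudo_dist a b = pseudo_dist b a"
proof -
  have "norm (1 - cnj a * b) = norm (cnj (1 - cnj a * b))" by (simp only: complex_mod_cnj)
  then show ?thesis
    by (simp add: pseudo_dist_def Moebius_function_simple norm_divide norm_minus_commute mult.commute)
qed

text \<open>This and the two estimates after it compare the pseudo-hyperbolic distance with the Euclidean one,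
  which is what turns the distance-decreasing property into a Lipschitz bound.\<close>

lemma norm_one_minus_cnj_mult_le: "1 - norm a \<le> norm (1 - cnj a * b)" if "norm b < 1"
proof -
  have "norm (cnj a * b) \<le> norm a"
    using that by (simp add: norm_mult mult_left_le)
  then show ?thesis
    using norm_triangle_ineq2[of 1 "cnj a * b"] by simp
qed

lemma pseudo_dist_le:
  assumes "norm a \<le> d" "d < 1" "norm b < 1"
  shows "pseudo_dist a b \<le> norm (b - a) / (1 - d)"
proof -
  have "1 - d \<le> norm (1 - cnj a * b)"
    using norm_one_minus_cnj_mult_le[of b a] assms by linarith
  then show ?thesis
    using assms unfolding pseudo_dist_def Moebius_function_simple norm_divide
    by (intro divide_left_mono) (auto intro!: mult_pos_pos)
qed

lemma norm_diff_le_pseudo_dist: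
  assumes "norm a < 1" "norm b < 1"
  shows "norm (b - a) \<le> 2 * pseudo_dist a b"
proof -
  have pos: "norm (1 - cnj a * b) > 0"
    using norm_one_minus_cnj_mult_le[of b a] assms by linarith
  have "norm (cnj a * b) \<le> 1"
    using assms by (simp add: norm_mult mult_le_one)
  then have "norm (1 - cnj a * b) \<le> 2"
    using norm_triangle_ineq4[of 1 "cnj a * b"] by simp
  then have "norm (b - a) * norm (1 - cnj a * b) \<le> norm (b - a) * 2"
    by (intro mult_left_mono) auto
  then show ?thesis
    using pos by (simp add: pseudo_dist_def Moebius_function_simple norm_divide field_simps)
qed

lemma pseudo_dist_common_bound:
  fixes p q :: "complex ^ 'm::finite"
  assumes "p \<in> polydisc" "q \<in> polydisc"
  obtains m where "0 < m" "m < 1" "\<And>i. pseudo_dist (p $ i) (q $ i) \<le> m"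
proof
  \<comment> \<open>the element 1/2 keeps the bound positive when the two points coincide\<close>
  let ?S = "insert (1/2) (range (\<lambda>i. pseudo_dist (p $ i) (q $ i)))"
  show "0 < Max ?S"
    by (subst Max_gr_iff) (auto intro: bexI[of _ "1/2"])
  show "Max ?S < 1"
    using assms by (subst Max_less_iff) (auto simp: polydisc_def intro: pseudo_dist_less_1)
  show "pseudo_dist (p $ i) (q $ i) \<le> Max ?S" for i
    by (intro Max_ge) auto
qed

section \<open>Restriction to analytic discs and the Schwarz-Pick inequality\<close>

lemma open_polydisc: "open (polydisc :: (complex ^ 'm::finite) set)"
proof -
  have "polydisc = (\<Inter>i. {z :: complex ^ 'm. norm (z $ i) < 1})"
    by (auto simp: polydisc_def)
  also have "open \<dots>"
    by (intro open_INT) (auto intro!: open_Collect_less continuous_intros)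
  finally show ?thesis .
qed

lemma has_derivative_vec_of_components:
  fixes g :: "complex \<Rightarrow> complex ^ 'm::finite"
  assumes "\<And>i. ((\<lambda>\<zeta>. g \<zeta> $ i) has_field_derivative d $ i) (at x)"
  shows "(g has_derivative (\<lambda>h. h *s d)) (at x)"
proof -
  have lim: "((\<lambda>y. (((g y - g x) - (y - x) *s d) /\<^sub>R norm (y - x)) $ i) \<longlongrightarrow> 0 $ i) (at x)" for i
    using assms[of i] unfolding has_field_derivative_def has_derivative_at_within
    by (simp add: algebra_simps)
  have bl: "bounded_linear (\<lambda>h::complex. h *s d)"
  proof (rule linear_conv_bounded_linear[THEN iffD1], unfold_locales)
  qed (auto simp: vec_eq_iff algebra_simps)
  show ?thesis
    unfolding has_derivative_at_within
    using bl vec_tendstoI[OF lim] by simp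
qed

text \<open>The chain rule reduces several variables to one: complex linearity of the derivative of \<open>F\<close> is
  exactly what makes the composite complex differentiable.\<close>

lemma holomorphic_along_disc:
  fixes F :: "complex ^ 'm::finite \<Rightarrow> complex"
  assumes F: "F holomorphic_several_on polydisc" and "open S"
    and g: "\<And>i. (\<lambda>\<zeta>. g \<zeta> $ i) holomorphic_on S" and into: "\<And>\<zeta>. \<zeta> \<in> S \<Longrightarrow> g \<zeta> \<in> polydisc"
  shows "(\<lambda>\<zeta>. F (g \<zeta>)) holomorphic_on S"
proof -
  have "(\<lambda>\<zeta>. F (g \<zeta>)) field_differentiable at x" if x: "x \<in> S" for x
  proof -
    obtain f' where f': "(F has_derivative f') (at (g x))" and lin: "Vector_Spaces.linear (*s) (*) f'"
      using F into[OF x] unfolding holomorphic_several_on_def by blast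
    define d where "d = (\<chi> i. deriv (\<lambda>\<zeta>. g \<zeta> $ i) x)"
    interpret Vector_Spaces.linear "(*s)" "(*)" f' by (rule lin)
    have "(g has_derivative (\<lambda>h. h *s d)) (at x)"
      using g \<open>open S\<close> x
      by (intro has_derivative_vec_of_components) (auto simp: d_def intro: holomorphic_derivI)
    from diff_chain_at[OF this f']
    have "((\<lambda>\<zeta>. F (g \<zeta>)) has_derivative (\<lambda>h. f' (h *s d))) (at x)"
      by (simp add: o_def)
    moreover have "f' (h *s d) = f' d * h" for h
      by (simp add: scale)
    ultimately show ?thesis
      unfolding field_differentiable_def has_field_derivative_def by (metis (no_types, lifting) ext)
  qed
  then show ?thesis
    by (simp add: \<open>open S\<close> holomorphic_on_open field_differentiable_def)
qed

lemma holomorphic_slice: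
  fixes F :: "complex ^ ('n::finite) option \<Rightarrow> complex"
  assumes "F holomorphic_several_on polydisc" "z \<in> polydisc"
  shows "(\<lambda>w. F (point z w)) holomorphic_on ball 0 1"
proof (rule holomorphic_along_disc[OF assms(1)])
  show "(\<lambda>w. point z w $ i) holomorphic_on ball 0 1" for i
    by (cases i) (auto simp: point_def intro!: holomorphic_intros)
qed (use assms in auto)

text \<open>In coordinate \<open>i\<close>, move \<open>p\<^sub>i\<close> to the origin by a Moebius map, where \<open>q\<^sub>i\<close> becomes a number of modulus
  at most \<open>m\<close>. The linear disc through the origin that reaches this number at parameter \<open>m\<close> stays in the
  unit disc; then move back. A common parameter \<open>m\<close> for all coordinates is what makes the maximum of
  the coordinate distances the right distance on the polydisc.\<close>

lemma analytic_disc_through: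
  fixes p q :: "complex ^ 'm::finite"
  assumes "p \<in> polydisc" "q \<in> polydisc" "0 < m" "m < 1"
    and close: "\<And>i. pseudo_dist (p $ i) (q $ i) \<le> m"
  obtains g where "\<And>i. (\<lambda>\<zeta>. g \<zeta> $ i) holomorphic_on ball 0 1"
    "\<And>\<zeta>. \<zeta> \<in> ball 0 1 \<Longrightarrow> g \<zeta> \<in> polydisc" "g 0 = p" "g (of_real m) = q"
proof
  let ?u = "\<lambda>i. disc_aut (p $ i) (q $ i) / of_real m"
  define g where "g = (\<lambda>\<zeta>. \<chi> i. disc_aut (- (p $ i)) (\<zeta> * ?u i))"
  have pq: "norm (p $ i) < 1" "norm (q $ i) < 1" for i
    using assms by (auto simp: polydisc_def)
  have u: "norm (?u i) \<le> 1" for i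
    using close[of i] \<open>0 < m\<close> by (simp add: pseudo_dist_def norm_divide)
  have small: "norm (\<zeta> * ?u i) < 1" if "norm \<zeta> < 1" for \<zeta> i
    using mult_mono[OF order_refl u[of i], of "norm \<zeta>"] that by (simp add: norm_mult norm_divide)
  show "(\<lambda>\<zeta>. g \<zeta> $ i) holomorphic_on ball 0 1" for i
  proof -
    have "(disc_aut (- (p $ i)) \<circ> (\<lambda>\<zeta>. \<zeta> * ?u i)) holomorphic_on ball 0 1"
      using pq small
      by (intro holomorphic_on_compose_gen[where t = "ball 0 1"] Moebius_function_holomorphic holomorphic_intros)
        (use \<open>0 < m\<close> in auto)
    then show ?thesis by (simp add: g_def o_def)
  qed
  show "g \<zeta> \<in> polydisc" if "\<zeta> \<in> ball 0 1" for \<zeta>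
    using that pq small by (auto simp: polydisc_def g_def intro!: disc_aut_in_disc)
  show "g 0 = p" by (simp add: g_def vec_eq_iff)
  show "g (of_real m) = q"
    using \<open>0 < m\<close> pq by (simp add: g_def vec_eq_iff disc_aut_inverse)
qed

text \<open>If \<open>F\<close> attained modulus 1 somewhere, the maximum principle on an analytic disc through that point
  and \<open>p0\<close> would give modulus 1 at \<open>p0\<close>.\<close>

lemma maps_into_open_disc:
  fixes F :: "complex ^ 'm::finite \<Rightarrow> complex"
  assumes F: "F holomorphic_several_on polydisc" and le: "\<And>p. p \<in> polydisc \<Longrightarrow> norm (F p) \<le> 1"
    and p0: "p0 \<in> polydisc" "norm (F p0) < 1"
  shows "F \<in> polydisc \<rightarrow> ball 0 1"
proof
  fix p :: "complex ^ 'm" assume p: "p \<in> polydisc"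
  show "F p \<in> ball 0 1"
  proof (rule ccontr)
    assume "F p \<notin> ball 0 1"
    then have 1: "norm (F p) \<ge> 1" by simp
    obtain m where m: "0 < m" "m < 1" "\<And>i. pseudo_dist (p0 $ i) (p $ i) \<le> m"
      using pseudo_dist_common_bound[OF p0(1) p] by blast
    obtain g where g: "\<And>i. (\<lambda>\<zeta>. g \<zeta> $ i) holomorphic_on ball 0 1"
      "\<And>\<zeta>. \<zeta> \<in> ball 0 1 \<Longrightarrow> g \<zeta> \<in> polydisc" "g 0 = p0" "g (of_real m) = p"
      using analytic_disc_through[OF p0(1) p m] by blast
    have hol: "(\<lambda>\<zeta>. F (g \<zeta>)) holomorphic_on ball 0 1"
      using holomorphic_along_disc[OF F _ g(1) g(2)] by simp
    have "(\<lambda>\<zeta>. F (g \<zeta>)) constant_on ball 0 1"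
    proof (rule maximum_modulus_principle[OF hol, where U = "ball 0 1" and \<xi> = "of_real m"])
      show "cmod (F (g z)) \<le> cmod (F (g (complex_of_real m)))" if "z \<in> ball 0 1" for z
        using le[OF g(2)[OF that]] 1 g(4) by simp
    qed (use m in auto)
    moreover have "0 \<in> ball (0::complex) 1" "complex_of_real m \<in> ball 0 1"
      using m by auto
    ultimately have "F (g 0) = F (g (of_real m))"
      unfolding constant_on_def by metis
    then show False using 1 p0 g by simp
  qed
qed

text \<open>The Schwarz lemma, applied to \<open>F\<close> along the analytic disc from \<open>p\<close> (parameter 0) to \<open>q\<close> (parameter
  \<open>m\<close>) after the value \<open>F p\<close> has been moved to 0.\<close>

lemma schwarz_pick_polydisc:
  fixes F :: "complex ^ 'm::finite \<Rightarrow> complex"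
  assumes F: "F holomorphic_several_on polydisc" "F \<in> polydisc \<rightarrow> ball 0 1"
    and pq: "p \<in> polydisc" "q \<in> polydisc" and m: "0 < m" "m < 1"
    and close: "\<And>i. pseudo_dist (p $ i) (q $ i) \<le> m"
  shows "pseudo_dist (F p) (F q) \<le> m"
proof -
  obtain g where g: "\<And>i. (\<lambda>\<zeta>. g \<zeta> $ i) holomorphic_on ball 0 1"
    "\<And>\<zeta>. \<zeta> \<in> ball 0 1 \<Longrightarrow> g \<zeta> \<in> polydisc" "g 0 = p" "g (of_real m) = q"
    using analytic_disc_through[OF pq m close] by blast
  have Fp: "norm (F p) < 1" using F pq by auto
  have into: "norm (F (g \<zeta>)) < 1" if "norm \<zeta> < 1" for \<zeta>
    using F(2) g(2)[of \<zeta>] that by auto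
  let ?u = "\<lambda>\<zeta>. disc_aut (F p) (F (g \<zeta>))"
  have "(disc_aut (F p) \<circ> (\<lambda>\<zeta>. F (g \<zeta>))) holomorphic_on ball 0 1"
    using Fp into
    by (intro holomorphic_on_compose_gen[where t = "ball 0 1"] Moebius_function_holomorphic
        holomorphic_along_disc[OF F(1) _ g(1) g(2)]) auto
  then have "?u holomorphic_on ball 0 1" by (simp add: o_def)
  from Schwarz_Lemma(1)[OF this, of "of_real m"]
  have "norm (?u (of_real m)) \<le> norm (complex_of_real m)"
    using g(3) m Fp into by (simp add: disc_aut_in_disc)
  then show ?thesis using m g(4) by (simp add: pseudo_dist_def)
qed
section \<open>Fixed points of the slices\<close>

text \<open>The slice over \<open>z\<close> alone might be a self-map of the disc without fixed points, whose approximate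
  fixed points run off to the boundary. The fixed point over \<open>z0\<close> prevents this: the Schwarz-Pick
  inequality on the whole polydisc confines the approximate fixed points to radius \<open>m\<close> around \<open>w0\<close>.\<close>

lemma fixed_point_persists:
  fixes F :: "complex ^ ('n::finite) option \<Rightarrow> complex"
  assumes F: "F holomorphic_several_on polydisc" "F \<in> polydisc \<rightarrow> ball 0 1"
    and z: "z0 \<in> polydisc" "z \<in> polydisc" and w0: "norm w0 < 1" "F (point z0 w0) = w0"
    and m: "0 < m" "m < 1" and close: "\<And>i. pseudo_dist (z0 $ i) (z $ i) \<le> m"
  obtains w where "norm w < 1" "F (point z w) = w" "pseudo_dist w0 w \<le> m"
proof -
  \<comment> \<open>the slice over \<open>z\<close> in a coordinate of the disc that puts \<open>w0\<close> at the origin\<close>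
  define T where "T = (\<lambda>\<zeta>. disc_aut w0 (F (point z (disc_aut (- w0) \<zeta>))))"
  have in_disc: "norm (disc_aut (- w0) \<zeta>) < 1" if "norm \<zeta> < 1" for \<zeta>
    using that w0 by (simp add: disc_aut_in_disc)
  have Fin: "norm (F (point z w)) < 1" if "norm w < 1" for w
    using F(2) z that by auto
  have "(disc_aut w0 \<circ> ((\<lambda>w. F (point z w)) \<circ> disc_aut (- w0))) holomorphic_on ball 0 1"
    using w0 in_disc Fin
    by (intro holomorphic_on_compose_gen[where t = "ball 0 1"] Moebius_function_holomorphic
        holomorphic_slice[OF F(1) z(2)]) auto
  then have holT: "T holomorphic_on ball 0 1"
    by (simp add: T_def o_def)
  have Tin: "norm (T \<zeta>) < 1" if "norm \<zeta> < 1" for \<zeta>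
    using that w0 by (auto simp: T_def intro!: disc_aut_in_disc Fin in_disc)
  have approx: "\<exists>b. norm b \<le> m \<and> b = of_real r * T b" if r: "0 < r" "r < 1" for r
  proof -
    have sub: "cball (0::complex) r \<subseteq> ball 0 1" using r by auto
    have cont: "continuous_on (cball 0 r) (\<lambda>\<zeta>. of_real r * T \<zeta>)"
      by (intro continuous_intros holomorphic_on_imp_continuous_on holomorphic_on_subset[OF holT sub])
    have "(\<lambda>\<zeta>. of_real r * T \<zeta>) \<in> cball 0 r \<rightarrow> cball 0 r"
    proof
      fix \<zeta> :: complex assume "\<zeta> \<in> cball 0 r"
      then have "norm (T \<zeta>) \<le> 1" using Tin[of \<zeta>] r by auto
      then show "of_real r * T \<zeta> \<in> cball 0 r"
        using r by (simp add: norm_mult mult_left_le)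
    qed
    from brouwer_ball[OF \<open>0 < r\<close> cont this]
    obtain b where b: "b \<in> cball 0 r" "of_real r * T b = b" by blast
    have "norm b \<le> m"
    proof (rule ccontr)
      assume "\<not> norm b \<le> m"
      then have big: "m < norm b" by simp
      \<comment> \<open>then \<open>b\<close> dominates the distances in the other coordinates, so Schwarz-Pick gives \<open>|T b| \<le> |b|\<close>\<close>
      have b1: "norm b < 1" using b r by simp
      have "pseudo_dist (F (point z0 w0)) (F (point z (disc_aut (- w0) b))) \<le> norm b"
      proof (rule schwarz_pick_polydisc[OF F])
        show "pseudo_dist (point z0 w0 $ i) (point z (disc_aut (- w0) b) $ i) \<le> norm b" for i
          using close big w0 b1
          by (cases i) (auto simp: point_def pseudo_dist_disc_aut intro: order_trans less_imp_le)
      qed (use z w0 in_disc[OF b1] b1 big m in auto)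
      then have "norm (T b) \<le> norm b"
        by (simp add: T_def pseudo_dist_def w0)
      moreover have "norm b = r * norm (T b)"
        using arg_cong[OF b(2), of norm] r by (simp add: norm_mult)
      ultimately have "norm b \<le> r * norm b" using r by (simp add: mult_left_mono)
      moreover have "r * norm b < 1 * norm b"
        using r big m by (intro mult_strict_right_mono) auto
      ultimately show False by simp
    qed
    then show ?thesis using b by metis
  qed
  define r where "r = (\<lambda>k. 1 - 1 / (real k + 2))"
  have "\<forall>k. \<exists>b. norm b \<le> m \<and> b = of_real (r k) * T b"
    by (intro allI approx) (auto simp: r_def field_simps)
  then obtain b where b: "\<And>k. norm (b k) \<le> m" "\<And>k. b k = of_real (r k) * T (b k)"
    by metis
  have "compact (cball (0::complex) m)" by simp
  then obtain l and s :: "nat \<Rightarrow> nat" where l: "l \<in> cball 0 m" "strict_mono s" "(b \<circ> s) \<longlonglongrightarrow> l"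
    using b(1) unfolding compact_def by (metis mem_cball_0)
  have l1: "norm l < 1" using l(1) m by simp
  have "r \<longlonglongrightarrow> 1" unfolding r_def by real_asymp
  then have "(\<lambda>k. r (s k)) \<longlonglongrightarrow> 1" using LIMSEQ_subseq_LIMSEQ[OF _ l(2)] by (simp add: o_def)
  moreover have "isCont T l"
    using holomorphic_on_imp_continuous_on[OF holT] l1
    by (simp add: continuous_on_eq_continuous_at)
  ultimately have "(\<lambda>k. of_real (r (s k)) * T (b (s k))) \<longlonglongrightarrow> of_real 1 * T l"
    using l(3) by (intro tendsto_intros isCont_tendsto_compose[of l T]) (auto simp: o_def)
  then have "(b \<circ> s) \<longlonglongrightarrow> T l" using b(2) by (simp add: o_def)
  then have Tl: "T l = l" using l(3) LIMSEQ_unique by blast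
  show ?thesis
  proof
    show "norm (disc_aut (- w0) l) < 1" by (rule in_disc[OF l1])
    show "F (point z (disc_aut (- w0) l)) = disc_aut (- w0) l"
      using Tl w0 Fin[OF in_disc[OF l1]] unfolding T_def by (metis disc_aut_inverse(2))
    show "pseudo_dist w0 (disc_aut (- w0) l) \<le> m"
      using l(1) l1 w0 by (simp add: pseudo_dist_disc_aut)
  qed
qed

text \<open>After moving \<open>a\<close> to the origin, either alternative in the hypothesis is a case of equality in the
  Schwarz lemma. The map is then a rotation, and the second fixed point or the value of the
  derivative forces the rotation to be trivial.\<close>

lemma disc_self_map_eq_id:
  assumes T: "T holomorphic_on ball 0 1" "\<And>\<zeta>. norm \<zeta> < 1 \<Longrightarrow> norm (T \<zeta>) < 1"
    and a: "norm a < 1" "T a = a"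
    and rigid: "(\<exists>b. norm b < 1 \<and> b \<noteq> a \<and> T b = b) \<or> (T has_field_derivative 1) (at a)"
    and \<zeta>: "norm \<zeta> < 1"
  shows "T \<zeta> = \<zeta>"
proof -
  define S where "S = disc_aut a \<circ> (T \<circ> disc_aut (- a))"
  have in_disc: "norm (disc_aut (- a) x) < 1" "norm (disc_aut a x) < 1" if "norm x < 1" for x
    using that a by (simp_all add: disc_aut_in_disc)
  have holS: "S holomorphic_on ball 0 1"
    unfolding S_def using a in_disc T
    by (intro holomorphic_on_compose_gen[where t = "ball 0 1"] Moebius_function_holomorphic) auto
  have S0: "S 0 = 0" by (simp add: S_def a)
  have Sin: "norm (S x) < 1" if "norm x < 1" for x
    using that by (simp add: S_def in_disc T)
  have S_eq: "S (disc_aut a x) = disc_aut a (T x)" if "norm x < 1" for x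
    using that a by (simp add: S_def disc_aut_inverse)
  have "\<exists>\<alpha>. (\<forall>x. norm x < 1 \<longrightarrow> S x = \<alpha> * x) \<and> \<alpha> = 1"
    using rigid
  proof
    assume "\<exists>b. norm b < 1 \<and> b \<noteq> a \<and> T b = b"
    then obtain b where b: "norm b < 1" "b \<noteq> a" "T b = b" by blast
    let ?c = "disc_aut a b"
    have c: "norm ?c < 1" "S ?c = ?c" using b in_disc S_eq by auto
    have "?c \<noteq> 0" using disc_aut_eq_iff[of a b a] a b by simp
    then have "\<exists>x. norm x < 1 \<and> x \<noteq> 0 \<and> norm (S x) = norm x"
      using c by (intro exI[of _ ?c]) simp
    with Schwarz_Lemma(3)[OF holS S0 Sin, of 0]
    obtain \<alpha> where \<alpha>: "\<And>x. norm x < 1 \<Longrightarrow> S x = \<alpha> * x" by (metis norm_zero zero_less_one)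
    with \<alpha>[of ?c] c \<open>?c \<noteq> 0\<close> show ?thesis by auto
  next
    assume T': "(T has_field_derivative 1) (at a)"
    obtain D where D: "(disc_aut (- a) has_field_derivative D) (at 0)"
      using holomorphic_derivI[OF Moebius_function_holomorphic[of "- a" 0] open_ball, of 0] a
      by auto
    obtain E where E: "(disc_aut a has_field_derivative E) (at a)"
      using holomorphic_derivI[OF Moebius_function_holomorphic[of "a" 0] open_ball, of a] a
      by auto
    \<comment> \<open>the two changes of coordinate are mutually inverse, so conjugation keeps the derivative 1\<close>
    have "((disc_aut a \<circ> disc_aut (- a)) has_field_derivative E * D) (at 0)"
      using D E by (intro DERIV_chain) auto
    moreover have "((disc_aut a \<circ> disc_aut (- a)) has_field_derivative 1) (at 0)"
      by (rule has_field_derivative_transform_within_open[where f = "\<lambda>x. x" and S = "ball 0 1"])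
        (use a in \<open>auto simp: disc_aut_inverse\<close>)
    ultimately have ED: "E * D = 1" by (rule DERIV_unique)
    have "((T \<circ> disc_aut (- a)) has_field_derivative 1 * D) (at 0)"
      using D T' by (intro DERIV_chain) auto
    then have S': "(S has_field_derivative 1) (at 0)"
      unfolding S_def using E a ED DERIV_chain[of "disc_aut a" E "T \<circ> disc_aut (- a)" 0 "1 * D" UNIV] by simp
    then have "norm (deriv S 0) = 1" by (simp add: DERIV_imp_deriv)
    with Schwarz_Lemma(3)[OF holS S0 Sin, of 0]
    obtain \<alpha> where \<alpha>: "\<And>x. norm x < 1 \<Longrightarrow> S x = \<alpha> * x" by (metis norm_zero zero_less_one)
    have "(S has_field_derivative \<alpha>) (at 0)"
      by (rule has_field_derivative_transform_within_open[where f = "\<lambda>x. \<alpha> * x" and S = "ball 0 1"])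
        (auto intro!: derivative_eq_intros simp: \<alpha>)
    then have "\<alpha> = 1" using S' DERIV_unique by blast
    with \<alpha> show ?thesis by auto
  qed
  then have "S (disc_aut a \<zeta>) = disc_aut a \<zeta>" using in_disc[OF \<zeta>] by simp
  then show ?thesis
    using S_eq[OF \<zeta>] disc_aut_eq_iff[of a "T \<zeta>" \<zeta>] a T \<zeta> by simp
qed

text \<open>Every \<open>w\<close> is a fixed point over \<open>z0\<close>, so by persistence the slice over \<open>z\<close> has a fixed point within
  distance \<open>m < 1\<close> of any given \<open>w\<close>. As the disc has diameter 1 for the pseudo-hyperbolic distance, no single
  fixed point can serve all \<open>w\<close>; two fixed points make the slice the identity.\<close>

lemma identity_slice_spreads:
  fixes F :: "complex ^ ('n::finite) option \<Rightarrow> complex"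
  assumes F: "F holomorphic_several_on polydisc" "F \<in> polydisc \<rightarrow> ball 0 1"
    and z: "z0 \<in> polydisc" "z \<in> polydisc" and id: "\<And>w. norm w < 1 \<Longrightarrow> F (point z0 w) = w"
    and w: "norm w < 1"
  shows "F (point z w) = w"
proof -
  obtain m where m: "0 < m" "m < 1" "\<And>i. pseudo_dist (z0 $ i) (z $ i) \<le> m"
    using pseudo_dist_common_bound[OF z] by blast
  have near: "\<exists>b. norm b < 1 \<and> F (point z b) = b \<and> pseudo_dist w b \<le> m" if "norm w < 1" for w
    using fixed_point_persists[OF F z that id[OF that] m] by blast
  obtain a where a: "norm a < 1" "F (point z a) = a" using near[of 0] by auto
  obtain s where s: "m < s" "s < 1" using dense m(2) by blast
  \<comment> \<open>a point at distance \<open>s > m\<close> from the first fixed point \<open>a\<close>: the fixed point near it is a new one\<close>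
  let ?w = "disc_aut (- a) (of_real s)"
  have w': "norm ?w < 1" using a s m by (intro disc_aut_in_disc) auto
  obtain b where b: "norm b < 1" "F (point z b) = b" "pseudo_dist ?w b \<le> m"
    using near[OF w'] by blast
  have "pseudo_dist a ?w = s" using a s m by (simp add: pseudo_dist_disc_aut)
  then have "b \<noteq> a" using b(3) s by (auto simp: pseudo_dist_commute)
  then show ?thesis
    using disc_self_map_eq_id[where T = "\<lambda>w. F (point z w)", OF holomorphic_slice[OF F(1) z(2)] _ a _ w]
      b F(2) z by fastforce
qed

lemma slice_fixed_point_unique:
  fixes F :: "complex ^ ('n::finite) option \<Rightarrow> complex"
  assumes F: "F holomorphic_several_on polydisc" "F \<in> polydisc \<rightarrow> ball 0 1" and z: "z \<in> polydisc"
    and nid: "\<exists>x. norm x < 1 \<and> F (point z x) \<noteq> x"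
    and w: "norm w < 1" "F (point z w) = w" and w': "norm w' < 1" "F (point z w') = w'"
  shows "w = w'"
proof (rule ccontr)
  assume "w \<noteq> w'"
  then have "F (point z x) = x" if "norm x < 1" for x
    using disc_self_map_eq_id[where T = "\<lambda>w. F (point z w)", OF holomorphic_slice[OF F(1) z] _ w _ that]
      w' F(2) z by fastforce
  with nid show False by blast
qed

section \<open>Holomorphic dependence of the fixed point\<close>

lemma bounded_linear_point: "bounded_linear (\<lambda>(h, \<omega>). point h \<omega>)"
proof (rule linear_conv_bounded_linear[THEN iffD1], rule linearI)
qed (auto simp: point_def vec_eq_iff split: option.splits)

text \<open>An implicit function theorem at a single point. The Lipschitz bound on \<open>f\<close> at \<open>z0\<close> makes the remainder of \<open>F\<close> at the point \<open>(z, f z)\<close> small compared with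
  \<open>|z - z0|\<close>, and the linearised equation is solved for \<open>f z - f z0\<close> by dividing by \<open>1 - \<partial>F/\<partial>w\<close>.\<close>

lemma has_derivative_fixed_point:
  fixes F :: "complex ^ ('n::finite) option \<Rightarrow> complex" and f :: "complex ^ 'n \<Rightarrow> complex"
  assumes F': "(F has_derivative L) (at (point z0 (f z0)))"
    and lin: "Vector_Spaces.linear (*s) (*) L" and c: "L (point 0 1) \<noteq> 1"
    and "\<delta> > 0" and "C \<ge> 0"
    and fixp: "\<And>z. norm (z - z0) < \<delta> \<Longrightarrow> F (point z (f z)) = f z"
    and lip: "\<And>z. norm (z - z0) < \<delta> \<Longrightarrow> norm (f z - f z0) \<le> C * norm (z - z0)"
  shows "(f has_derivative (\<lambda>h. L (point h 0) / (1 - L (point 0 1)))) (at z0)"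
  unfolding has_derivative_at_alt
proof (intro conjI allI impI)
  interpret L: Vector_Spaces.linear "(*s)" "(*)" L by (rule lin)
  let ?c = "L (point 0 1)"
  let ?D = "\<lambda>h. L (point h 0) / (1 - ?c)"
  have "bounded_linear (\<lambda>h. L (case (h, 0) of (h, \<omega>) \<Rightarrow> point h \<omega>))"
    by (intro bounded_linear_compose[OF has_derivative_bounded_linear[OF F']]
        bounded_linear_compose[OF bounded_linear_point] bounded_linear_Pair
        bounded_linear_ident bounded_linear_zero)
  then show "bounded_linear ?D"
    using bounded_linear_compose[OF bounded_linear_divide[of "1 - ?c"]] by simp
  fix e :: real assume "e > 0"
  obtain K where K: "K > 0" "\<And>h \<omega>. norm (point h \<omega> :: complex ^ 'n option) \<le> norm (h, \<omega>) * K"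
    using bounded_linear.pos_bounded[OF bounded_linear_point] by auto
  define B where "B = K * (1 + C)"
  have "B > 0" using K \<open>C \<ge> 0\<close> by (simp add: B_def)
  \<comment> \<open>\<open>B\<close> bounds the increment of the point \<open>(z, f z)\<close>; \<open>e'\<close> absorbs \<open>B\<close> and the final division\<close>
  define e' where "e' = e * norm (1 - ?c) / B"
  have "e' > 0" using \<open>e > 0\<close> \<open>B > 0\<close> c by (simp add: e'_def)
  then obtain d where d: "d > 0" "\<And>p. norm (p - point z0 (f z0)) < d \<Longrightarrow>
      norm (F p - F (point z0 (f z0)) - L (p - point z0 (f z0))) \<le> e' * norm (p - point z0 (f z0))"
    using F' unfolding has_derivative_at_alt by blast
  show "\<exists>d>0. \<forall>z. norm (z - z0) < d \<longrightarrow> norm (f z - f z0 - ?D (z - z0)) \<le> e * norm (z - z0)"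
  proof (intro exI[of _ "min \<delta> (d / B)"] conjI allI impI)
    show "0 < min \<delta> (d / B)" using \<open>\<delta> > 0\<close> d(1) \<open>B > 0\<close> by simp
    fix z assume z: "norm (z - z0) < min \<delta> (d / B)"
    let ?h = "z - z0" and ?\<omega> = "f z - f z0"
    have diff: "point z (f z) - point z0 (f z0) = point ?h ?\<omega>"
      by (simp add: point_def vec_eq_iff split: option.splits)
    have split: "point ?h ?\<omega> = point ?h 0 + ?\<omega> *s point 0 1"
      by (simp add: point_def vec_eq_iff split: option.splits)
    have "norm (?h, ?\<omega>) \<le> norm ?h + C * norm ?h"
      using norm_Pair_le[of ?h ?\<omega>] lip[of z] z by simp
    then have le: "norm (point ?h ?\<omega> :: complex ^ 'n option) \<le> B * norm ?h"
      using order_trans[OF K(2) mult_right_mono[of "norm (?h, ?\<omega>)" "norm ?h + C * norm ?h" K]] K(1)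
      by (simp add: B_def algebra_simps)
    have "B * norm ?h < d" using z \<open>B > 0\<close> by (simp add: field_simps)
    with le have "norm (F (point z (f z)) - F (point z0 (f z0)) - L (point ?h ?\<omega>))
        \<le> e' * norm (point ?h ?\<omega> :: complex ^ 'n option)"
      using d(2)[of "point z (f z)"] unfolding diff by simp
    also have "\<dots> \<le> e' * (B * norm ?h)"
      using le \<open>e' > 0\<close> by (intro mult_left_mono) auto
    also have "\<dots> = norm (1 - ?c) * (e * norm ?h)"
      using \<open>B > 0\<close> by (simp add: e'_def)
    also have "F (point z (f z)) - F (point z0 (f z0)) - L (point ?h ?\<omega>)
        = (1 - ?c) * (?\<omega> - ?D ?h)"
      using fixp[of z] fixp[of z0] z \<open>\<delta> > 0\<close> c unfolding split L.add L.scale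
      by (simp add: field_simps)
    finally show "norm (?\<omega> - ?D ?h) \<le> e * norm ?h"
      using c by (simp add: norm_mult)
  qed
qed

text \<open>The preceding lemma applies at every point: the Lipschitz bound comes from persistence together
  with uniqueness of the fixed points, and \<open>\<partial>F/\<partial>w \<noteq> 1\<close> from the fact that a slice
  with derivative 1 at a fixed point is the identity.\<close>

lemma fixed_point_function_holomorphic:
  fixes F :: "complex ^ ('n::finite) option \<Rightarrow> complex" and f :: "complex ^ 'n \<Rightarrow> complex"
  assumes F: "F holomorphic_several_on polydisc" "F \<in> polydisc \<rightarrow> ball 0 1"
    and nid: "\<And>z. z \<in> polydisc \<Longrightarrow> \<exists>w. norm w < 1 \<and> F (point z w) \<noteq> w"
    and f: "\<And>z. z \<in> polydisc \<Longrightarrow> norm (f z) < 1" "\<And>z. z \<in> polydisc \<Longrightarrow> F (point z (f z)) = f z"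
  shows "f holomorphic_several_on polydisc"
  unfolding holomorphic_several_on_def
proof
  fix z0 :: "complex ^ 'n" assume z0: "z0 \<in> polydisc"
  have slice: "(\<lambda>w. F (point z w)) holomorphic_on ball 0 1"
    "\<And>w. norm w < 1 \<Longrightarrow> norm (F (point z w)) < 1" if "z \<in> polydisc" for z
    using holomorphic_slice[OF F(1) that] F(2) that by auto
  have unique: "w = f z" if "z \<in> polydisc" "norm w < 1" "F (point z w) = w" for z w
    by (rule slice_fixed_point_unique[OF F that(1) nid that(2,3) f]) (fact that(1))+
  have "(point z0 (f z0)) \<in> polydisc" using z0 f by simp
  then obtain L where L: "(F has_derivative L) (at (point z0 (f z0)))"
    and lin: "Vector_Spaces.linear (*s) (*) L"
    using F(1) unfolding holomorphic_several_on_def by blast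
  interpret L: Vector_Spaces.linear "(*s)" "(*)" L by (rule lin)
  have c: "L (point 0 1) \<noteq> 1"
  proof
    assume one: "L (point 0 1) = 1"
    have "(point z0 has_derivative (\<lambda>h. h *s point 0 1)) (at (f z0))"
    proof (rule has_derivative_vec_of_components)
      show "((\<lambda>w. point z0 w $ i) has_field_derivative point 0 1 $ i) (at (f z0))" for i
        by (cases i) (auto simp: point_def)
    qed
    from diff_chain_at[OF this L] have "((\<lambda>w. F (point z0 w)) has_field_derivative 1) (at (f z0))"
      by (simp add: o_def L.scale one has_field_derivative_def lambda_one)
    then show False
      using disc_self_map_eq_id[OF slice[OF z0] f[OF z0]] nid[OF z0] by blast
  qed
  define d where "d = Max (range (\<lambda>i. norm (z0 $ i)))"
  have d: "norm (z0 $ i) \<le> d" for i by (simp add: d_def)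
  have "d < 1" using z0 by (auto simp: d_def polydisc_def)
  obtain \<epsilon> where \<epsilon>: "\<epsilon> > 0" "ball z0 \<epsilon> \<subseteq> polydisc"
    using open_polydisc z0 open_contains_ball by blast
  define \<delta> where "\<delta> = min \<epsilon> (1 - d)"
  have "(f has_derivative (\<lambda>h. L (point h 0) / (1 - L (point 0 1)))) (at z0)"
  proof (rule has_derivative_fixed_point[where F = F and f = f, OF L lin c])
    show "\<delta> > 0" using \<epsilon> \<open>d < 1\<close> by (simp add: \<delta>_def)
    show "0 \<le> 2 / (1 - d)" using \<open>d < 1\<close> by simp
    fix z assume "norm (z - z0) < \<delta>"
    then have z: "z \<in> polydisc" and small: "norm (z - z0) < 1 - d"
      using \<epsilon>(2) by (auto simp: \<delta>_def dist_norm norm_minus_commute)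
    show "F (point z (f z)) = f z" by (rule f(2)[OF z])
    show "norm (f z - f z0) \<le> 2 / (1 - d) * norm (z - z0)"
    proof (cases "z = z0")
      case False
      define m where "m = norm (z - z0) / (1 - d)"
      have m: "0 < m" "m < 1" using False small \<open>d < 1\<close> by (auto simp: m_def)
      have "pseudo_dist (z0 $ i) (z $ i) \<le> m" for i
      proof -
        have "pseudo_dist (z0 $ i) (z $ i) \<le> norm (z $ i - z0 $ i) / (1 - d)"
          using z by (intro pseudo_dist_le d \<open>d < 1\<close>) (auto simp: polydisc_def)
        also have "norm (z $ i - z0 $ i) \<le> norm (z - z0)"
          using Finite_Cartesian_Product.norm_nth_le[of "z - z0" i] by simp
        finally show ?thesis using \<open>d < 1\<close> by (simp add: m_def divide_right_mono)
      qed
      from fixed_point_persists[OF F z0 z f[OF z0] m this]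
      obtain w where "norm w < 1" "F (point z w) = w" "pseudo_dist (f z0) w \<le> m" by blast
      then have "pseudo_dist (f z0) (f z) \<le> m" using unique[OF z] by blast
      then show ?thesis
        using norm_diff_le_pseudo_dist[of "f z0" "f z"] f(1) z z0 by (simp add: m_def)
    qed simp
  qed
  moreover have "Vector_Spaces.linear (*s) (*) (\<lambda>h. L (point h 0) / (1 - L (point 0 1)))"
  proof unfold_locales
    have add: "point (x + y) 0 = point x 0 + point y 0" for x y :: "complex ^ 'n"
      by (simp add: point_def vec_eq_iff split: option.splits)
    have scale: "point (r *s x) 0 = r *s point x 0" for r and x :: "complex ^ 'n"
      by (simp add: point_def vec_eq_iff split: option.splits)
    show "L (point (x + y) 0) / (1 - L (point 0 1)) =
        L (point x 0) / (1 - L (point 0 1)) + L (point y 0) / (1 - L (point 0 1))" for x y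
      by (simp add: add L.add add_divide_distrib)
    show "L (point (r *s x) 0) / (1 - L (point 0 1)) = r * (L (point x 0) / (1 - L (point 0 1)))" for r x
      by (simp add: scale L.scale)
  qed
  ultimately show "\<exists>f'. (f has_derivative f') (at z0) \<and> Vector_Spaces.linear (*s) (*) f'"
    by blast
qed

section \<open>The graph of fixed points\<close>

lemma polydisc_coords: "p \<in> polydisc \<longleftrightarrow> z_coords p \<in> polydisc \<and> norm (w_coord p) < 1"
  by (metis mem_ball_0 point_coords point_in_polydisc_iff)

theorem theorem3p1:
  fixes V :: "(complex ^ ('n::finite) option) set"
    and F :: "complex ^ ('n::finite) option \<Rightarrow> complex"
  assumes "V \<subseteq> polydisc"
    and "\<exists>p\<in>V. \<exists>q\<in>V. w_coord p \<noteq> w_coord q"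
    and "nontrivial_norm1_extension V F"
  shows "\<exists>!f. f \<in> polydisc \<rightarrow>\<^sub>E ball 0 1 \<and>
              f holomorphic_several_on polydisc \<and>
              (\<forall>z\<in>polydisc. F (point z (f z)) = f z) \<and>
              V = {point z (f z) | z. z \<in> z_coords ` V}"
proof -
  have hol: "F holomorphic_several_on polydisc" and nontriv: "\<exists>p\<in>polydisc. F p \<noteq> w_coord p"
    and FV: "\<And>p. p \<in> V \<Longrightarrow> F p = w_coord p" and le: "\<And>p. p \<in> polydisc \<Longrightarrow> norm (F p) \<le> 1"
    using assms(3) unfolding nontrivial_norm1_extension_def by auto
  have V_coords: "z_coords p \<in> polydisc" "norm (w_coord p) < 1" if "p \<in> V" for p
    using subsetD[OF assms(1) that] polydisc_coords by blast+
  have V_fix: "F (point (z_coords p) (w_coord p)) = w_coord p" if "p \<in> V" for p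
    using FV[OF that] by simp
  obtain p0 where p0: "p0 \<in> V" using assms(2) by blast
  have into: "F \<in> polydisc \<rightarrow> ball 0 1"
    using maps_into_open_disc[OF hol le subsetD[OF assms(1) p0]] FV[OF p0] V_coords(2)[OF p0] by simp
  have nid: "\<exists>w. norm w < 1 \<and> F (point z w) \<noteq> w" if z: "z \<in> polydisc" for z
  proof (rule ccontr)
    assume "\<not> (\<exists>w. norm w < 1 \<and> F (point z w) \<noteq> w)"
    then have id: "\<And>w. norm w < 1 \<Longrightarrow> F (point z w) = w" by blast
    have "F p = w_coord p" if "p \<in> polydisc" for p
      using identity_slice_spreads[OF hol into z _ id, of "z_coords p" "w_coord p"]
        polydisc_coords[of p] that by simp
    then show False using nontriv by blast
  qed
  note unique = slice_fixed_point_unique[OF hol into _ nid]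
  have exists: "\<exists>w. norm w < 1 \<and> F (point z w) = w" if z: "z \<in> polydisc" for z
  proof -
    obtain m where "0 < m" "m < 1" "\<And>i. pseudo_dist (z_coords p0 $ i) (z $ i) \<le> m"
      using pseudo_dist_common_bound[OF V_coords(1)[OF p0] z] by blast
    from fixed_point_persists[OF hol into V_coords(1)[OF p0] z V_coords(2)[OF p0] V_fix[OF p0] this]
    obtain w where "norm w < 1" "F (point z w) = w" by metis
    then show ?thesis by blast
  qed
  define f where "f = (\<lambda>z\<in>polydisc. SOME w. norm w < 1 \<and> F (point z w) = w)"
  have f: "norm (f z) < 1" "F (point z (f z)) = f z" if z: "z \<in> polydisc" for z
  proof -
    have "norm (f z) < 1 \<and> F (point z (f z)) = f z"
      unfolding f_def restrict_apply'[OF z] by (rule someI_ex[OF exists[OF z]])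
    then show "norm (f z) < 1" "F (point z (f z)) = f z" by blast+
  qed
  have f_V: "f (z_coords p) = w_coord p" if "p \<in> V" for p
  proof -
    note z = V_coords(1)[OF that]
    show ?thesis by (rule unique[OF z z f[OF z] V_coords(2)[OF that] V_fix[OF that]])
  qed
  show ?thesis
  proof (rule ex1I[of _ f], intro conjI)
    show "f \<in> polydisc \<rightarrow>\<^sub>E ball 0 1"
      by (rule PiE_I) (use f(1) in simp, simp add: f_def)
    show "f holomorphic_several_on polydisc"
      by (rule fixed_point_function_holomorphic[OF hol into nid f])
    show "\<forall>z\<in>polydisc. F (point z (f z)) = f z" using f(2) by blast
    have "{point z (f z) | z. z \<in> z_coords ` V} = (\<lambda>p. point (z_coords p) (f (z_coords p))) ` V"
      by blast
    also have "\<dots> = (\<lambda>p. p) ` V"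
      by (rule image_cong) (simp_all add: f_V)
    finally show "V = {point z (f z) | z. z \<in> z_coords ` V}" by simp
  next
    fix g assume *: "g \<in> polydisc \<rightarrow>\<^sub>E ball 0 1 \<and> g holomorphic_several_on polydisc \<and>
        (\<forall>z\<in>polydisc. F (point z (g z)) = g z) \<and> V = {point z (g z) | z. z \<in> z_coords ` V}"
    note g = conjunct1[OF *] conjunct1[OF conjunct2[OF conjunct2[OF *]]]
    show "g = f"
    proof
      fix z :: "complex ^ 'n"
      show "g z = f z"
      proof (cases "z \<in> polydisc")
        case True
        have "norm (g z) < 1" using PiE_mem[OF g(1) True] by simp
        moreover have "F (point z (g z)) = g z" using g(2) True by blast
        ultimately show ?thesis by (rule unique[OF True True _ _ f[OF True]])
      next
        case False
        then show ?thesis using PiE_arb[OF g(1) False] by (simp add: f_def)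
      qed
    qed
  qed
qed

end
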